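(* Let $d\geq 2$ and let $\mathbb{S}^{2d-1}\subset\mathbb{C}^d$ be the unit sphere with its standard contact structure $\xi_{st}=\ker\left(\frac{i}{4}\sum_{j=1}^d(z_j\,d\bar z_j-\bar z_j\,dz_j)\right)$. Every closed proper subset of $(\mathbb{S}^{2d-1},\xi_{st})$ is displaceable.
   Context: A contact isotopy of a contact manifold $(V,\xi)$ is a smooth family $\{\varphi_t\}_{t\in[0,1]}$ of diffeomorphisms of $V$ preserving $\xi$. A subset $L\subset V$ is called displaceable if there is a contact isotopy $\{\varphi_t\}_{t\in[0,1]}$ of $(V,\xi)$ with $\varphi_0=\mathrm{id}$ and $\varphi_1(L)\cap L=\emptyset$. *)

theory Defs
  imports "HOL-Analysis.Analysis"
begin

text \<open>Meaningful for open \<open>S\<close>. In finite dimension, continuity of all iterated directional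
  derivatives is the usual condition of being \<open>k\<close> times continuously differentiable.\<close>

primrec Ck_on :: "nat \<Rightarrow> 'a::euclidean_space set \<Rightarrow> ('a \<Rightarrow> 'b::euclidean_space) \<Rightarrow> bool" where
  "Ck_on 0 S f \<longleftrightarrow> continuous_on S f"
| "Ck_on (Suc k) S f \<longleftrightarrow>
     (\<forall>x\<in>S. f differentiable (at x)) \<and>
     (\<forall>v. Ck_on k S (\<lambda>x. frechet_derivative f (at x) v))"

text \<open>Smoothness on an arbitrary subset \<open>A\<close> of a Euclidean space (used for embedded submanifolds,
  and for their products with \<open>[0,1]\<close>): locally, the map extends to a smooth map on an open
  subset of the ambient space.\<close>

definition smooth_on :: "'a::euclidean_space set \<Rightarrow> ('a \<Rightarrow> 'b::euclidean_space) \<Rightarrow> bool" where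
  "smooth_on A f \<longleftrightarrow>
     (\<forall>x\<in>A. \<exists>U g. open U \<and> x \<in> U \<and> (\<forall>k. Ck_on k U g) \<and> (\<forall>y\<in>U \<inter> A. g y = f y))"

definition diffeomorphism_of :: "'a::euclidean_space set \<Rightarrow> ('a \<Rightarrow> 'a) \<Rightarrow> bool" where
  "diffeomorphism_of V f \<longleftrightarrow>
     bij_betw f V V \<and> smooth_on V f \<and> smooth_on V (inv_into V f)"

text \<open>Here \<open>V\<close> is an embedded submanifold and \<open>\<xi> x\<close> is a subspace of its tangent space at \<open>x\<close>,
  seen inside the ambient space. A derivative \<open>D\<close> of \<open>f\<close> at \<open>x\<close> within \<open>V\<close> is not unique as a map
  on the ambient space, but its restriction to the tangent space of \<open>V\<close> at \<open>x\<close> is: it is the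
  differential of \<open>f\<close> at \<open>x\<close>.\<close>

definition preserves_distribution ::
  "'a::euclidean_space set \<Rightarrow> ('a \<Rightarrow> 'a set) \<Rightarrow> ('a \<Rightarrow> 'a) \<Rightarrow> bool" where
  "preserves_distribution V \<xi> f \<longleftrightarrow>
     (\<forall>x\<in>V. \<exists>D. (f has_derivative D) (at x within V) \<and> D ` \<xi> x = \<xi> (f x))"

definition contact_isotopy ::
  "'a::euclidean_space set \<Rightarrow> ('a \<Rightarrow> 'a set) \<Rightarrow> (real \<Rightarrow> 'a \<Rightarrow> 'a) \<Rightarrow> bool" where
  "contact_isotopy V \<xi> \<phi> \<longleftrightarrow>
     smooth_on ({0..1} \<times> V) (\<lambda>(t, x). \<phi> t x) \<and>
     (\<forall>t\<in>{0..1}. diffeomorphism_of V (\<phi> t) \<and> preserves_distribution V \<xi> (\<phi> t))"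

definition displaceable ::
  "'a::euclidean_space set \<Rightarrow> ('a \<Rightarrow> 'a set) \<Rightarrow> 'a set \<Rightarrow> bool" where
  "displaceable V \<xi> L \<longleftrightarrow>
     (\<exists>\<phi>. contact_isotopy V \<xi> \<phi> \<and> (\<forall>x\<in>V. \<phi> 0 x = x) \<and> \<phi> 1 ` L \<inter> L = {})"

text \<open>The value at the tangent vector \<open>v\<close> at \<open>z\<close> of the one-form
  \<open>(i/4) \<Sum>\<^sub>j (z\<^sub>j d(cnj z\<^sub>j) - cnj z\<^sub>j dz\<^sub>j)\<close>; it is a real number.\<close>

definition std_contact_form :: "complex ^ 'd \<Rightarrow> complex ^ 'd \<Rightarrow> complex" where
  "std_contact_form z v = \<i> / 4 * (\<Sum>j\<in>UNIV. z $ j * cnj (v $ j) - cnj (z $ j) * v $ j)"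

definition sphere_tangent_space :: "'a::euclidean_space \<Rightarrow> 'a set" where
  "sphere_tangent_space z = {v. z \<bullet> v = 0}"

definition std_contact_structure :: "complex ^ 'd \<Rightarrow> (complex ^ 'd) set" where
  "std_contact_structure z = {v \<in> sphere_tangent_space z. std_contact_form z v = 0}"

end

theory Submission
  imports Defs
begin

text \<open>
  The unit ball has a large group of holomorphic automorphisms, which extend to the sphere and
  preserve its standard contact structure, because the contact plane at \<open>z\<close> is the set of all \<open>v\<close>
  that are orthogonal to \<open>z\<close> for the Hermitian form. For a unit vector \<open>p\<close> the group contains a
  one-parameter subgroup \<open>boost p r\<close> that fixes \<open>p\<close> and \<open>-p\<close>; for large \<open>r\<close> it contracts the
  complement of any given neighbourhood of \<open>p\<close> into a small neighbourhood of \<open>-p\<close>.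

  Given a closed proper subset \<open>L\<close> of the sphere, choose \<open>p\<close> outside \<open>L\<close>. A boost with large
  parameter brings \<open>L\<close> close to \<open>-p\<close>, and the unitary map \<open>z \<mapsto> -z\<close> then brings it close to \<open>p\<close>,
  hence off \<open>L\<close>. Both maps are joined to the identity by contactomorphisms, so
  \<open>\<phi>\<^sub>t z = exp (i \<pi> t) boost p (k t) z\<close> displaces \<open>L\<close> once \<open>k\<close> is large
  (\<open>boost_attracts_to_antipode\<close>).

  The boosts are the projective form of Lorentz boosts: with \<open>N = boost_num p r\<close> and
  \<open>\<delta> = boost_den p r\<close>, the map \<open>(z, 1) \<mapsto> (N z, \<delta> z)\<close> extends to a linear isometry of the Hermitian
  form of signature \<open>(d, 1)\<close> (\<open>herm_boost_num_polarised\<close>). This identity gives both that \<open>N/\<delta>\<close>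
  preserves the sphere and, after differentiation, that it preserves the contact planes
  (\<open>boost_deriv_conformal\<close>). Smoothness holds since every map involved is built from linear maps,
  the exponential, products and quotients with nonzero denominators.
\<close>

section \<open>Calculus of \<open>Ck_on\<close>\<close>

text \<open>A derivative at \<open>x\<close> depends only on the germ at \<open>x\<close>, and two functions that agree on an open
  set have the same germs there.\<close>

lemma Ck_on_cong:
  assumes "open S" "\<And>x. x \<in> S \<Longrightarrow> f x = g x"
  shows "Ck_on k S f \<longleftrightarrow> Ck_on k S g"
  using assms(2)
proof (induction k arbitrary: f g)
  case 0
  then show ?case by (simp cong: continuous_on_cong)
next
  case (Suc k)
  have *: "(f has_derivative D) (at x) \<longleftrightarrow> (g has_derivative D) (at x)" if "x \<in> S" for x D
    using has_derivative_transform_within_open[OF _ \<open>open S\<close> that, of f D UNIV g]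
      has_derivative_transform_within_open[OF _ \<open>open S\<close> that, of g D UNIV f] Suc.prems
    by auto
  have "f differentiable (at x) \<longleftrightarrow> g differentiable (at x)" if "x \<in> S" for x
    using *[OF that] by (simp add: differentiable_def)
  moreover have "frechet_derivative f (at x) = frechet_derivative g (at x)" if "x \<in> S" for x
    using *[OF that] by (simp add: frechet_derivative_def)
  ultimately show ?case
    using Suc.IH[of "\<lambda>x. frechet_derivative f (at x) v" "\<lambda>x. frechet_derivative g (at x) v" for v]
    by auto
qed

text \<open>Allows the derivative to be written in closed form, so that the closure properties below
  follow by induction on \<open>k\<close> from the usual differentiation rules.\<close>

lemma Ck_on_SucI:
  assumes "open S" and f: "\<And>x. x \<in> S \<Longrightarrow> (f has_derivative f' x) (at x)"
    and "\<And>v. Ck_on k S (\<lambda>x. f' x v)"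
  shows "Ck_on (Suc k) S f"
proof -
  have "frechet_derivative f (at x) v = f' x v" if "x \<in> S" for x v
    using frechet_derivative_at[OF f[OF that]] by simp
  then have "Ck_on k S (\<lambda>x. frechet_derivative f (at x) v)" for v
    using assms(3)[of v] Ck_on_cong[OF \<open>open S\<close>, of "\<lambda>x. frechet_derivative f (at x) v" "\<lambda>x. f' x v"]
    by blast
  then show ?thesis
    using f by (auto simp: differentiable_def)
qed

lemma Ck_on_SucD:
  assumes "Ck_on (Suc k) S f" "x \<in> S"
  shows "(f has_derivative frechet_derivative f (at x)) (at x)"
  using assms by (simp add: frechet_derivative_works)

lemma Ck_on_frechet_derivative:
  "Ck_on (Suc k) S f \<Longrightarrow> Ck_on k S (\<lambda>x. frechet_derivative f (at x) v)"
  by simp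

lemma Ck_on_lower: "Ck_on (Suc k) S f \<Longrightarrow> Ck_on k S f"
proof (induction k arbitrary: f)
  case 0
  then show ?case
    by (simp add: continuous_at_imp_continuous_on differentiable_imp_continuous_within)
next
  case (Suc k)
  note * = Suc.prems[unfolded Ck_on.simps(2)[of "Suc k" S f]]
  have "Ck_on k S (\<lambda>x. frechet_derivative f (at x) v)" for v
    using * by (intro Suc.IH) blast
  then show ?case
    unfolding Ck_on.simps(2)[of k S f] using * by blast
qed

lemma Ck_on_const: "open S \<Longrightarrow> Ck_on k S (\<lambda>x. c)"
proof (induction k arbitrary: c)
  case (Suc k)
  show ?case
    by (rule Ck_on_SucI[OF Suc.prems has_derivative_const Suc.IH[OF Suc.prems]])
qed simp

lemma Ck_on_bounded_linear:
  assumes "open S" "bounded_linear f"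
  shows "Ck_on k S f"
proof (cases k)
  case 0
  then show ?thesis using assms by (simp add: linear_continuous_on)
next
  case (Suc m)
  show ?thesis
    unfolding Suc
    by (rule Ck_on_SucI[where f' = "\<lambda>x. f"])
      (use assms in \<open>auto intro: bounded_linear_imp_has_derivative Ck_on_const\<close>)
qed

lemma Ck_on_add:
  assumes "open S"
  shows "Ck_on k S f \<Longrightarrow> Ck_on k S g \<Longrightarrow> Ck_on k S (\<lambda>x. f x + g x)"
proof (induction k arbitrary: f g)
  case 0
  then show ?case by (auto intro: continuous_intros)
next
  case (Suc k)
  show ?case
    by (rule Ck_on_SucI[OF assms has_derivative_add[OF Suc.prems[THEN Ck_on_SucD]]])
      (assumption | intro Suc.IH Suc.prems[THEN Ck_on_frechet_derivative])+
qed

text \<open>By the product rule, the derivative is again a sum of two terms of the same form. The rule serves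
  for products of numbers and for scalar multiples of vectors.\<close>

lemma Ck_on_bounded_bilinear:
  assumes "open S" and B: "bounded_bilinear B"
  shows "Ck_on k S f \<Longrightarrow> Ck_on k S g \<Longrightarrow> Ck_on k S (\<lambda>x. B (f x) (g x))"
proof (induction k arbitrary: f g)
  case 0
  then show ?case by (auto intro: bounded_bilinear.continuous_on[OF B])
next
  case (Suc k)
  note * = Ck_on_lower[OF Suc.prems(1)] Ck_on_lower[OF Suc.prems(2)]
  show ?case
    by (rule Ck_on_SucI[OF assms(1) bounded_bilinear.FDERIV[OF B Suc.prems[THEN Ck_on_SucD]]])
      (assumption | intro Ck_on_add[OF \<open>open S\<close>] Suc.IH Suc.prems[THEN Ck_on_frechet_derivative] *)+
qed

lemma Ck_on_bounded_linear_compose: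
  assumes "open S" and T: "bounded_linear T"
  shows "Ck_on k S f \<Longrightarrow> Ck_on k S (\<lambda>x. T (f x))"
proof (induction k arbitrary: f)
  case 0
  then show ?case by (auto intro: bounded_linear.continuous_on[OF T])
next
  case (Suc k)
  show ?case
    by (rule Ck_on_SucI[OF assms(1) bounded_linear.has_derivative[OF T Suc.prems[THEN Ck_on_SucD]]])
      (assumption | intro Suc.IH Suc.prems[THEN Ck_on_frechet_derivative])+
qed

lemmas Ck_on_mult = Ck_on_bounded_bilinear[OF _ bounded_bilinear_mult]

lemma Ck_on_inverse:
  fixes f :: "'a::euclidean_space \<Rightarrow> 'b::{euclidean_space, real_normed_field}"
  assumes "open S" and nz: "\<And>x. x \<in> S \<Longrightarrow> f x \<noteq> 0"
  shows "Ck_on k S f \<Longrightarrow> Ck_on k S (\<lambda>x. inverse (f x))"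
proof (induction k)
  case 0
  then show ?case using nz by (auto intro: continuous_intros)
next
  case (Suc k)
  have inv: "Ck_on k S (\<lambda>x. inverse (f x))"
    by (rule Suc.IH[OF Ck_on_lower[OF Suc.prems]])
  show ?case
    by (rule Ck_on_SucI[OF assms(1) Deriv.has_derivative_inverse[OF nz Suc.prems[THEN Ck_on_SucD]]])
      (assumption | intro Ck_on_mult 
        Ck_on_bounded_linear_compose[OF _ bounded_linear_minus[OF bounded_linear_ident]]
        \<open>open S\<close> inv Suc.prems[THEN Ck_on_frechet_derivative])+
qed

lemma Ck_on_exp:
  fixes f :: "'a::euclidean_space \<Rightarrow> 'b::{euclidean_space, real_normed_field}"
  assumes "open S"
  shows "Ck_on k S f \<Longrightarrow> Ck_on k S (\<lambda>x. exp (f x))"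
proof (induction k)
  case 0
  then show ?case by (auto intro: continuous_intros)
next
  case (Suc k)
  have inv: "Ck_on k S (\<lambda>x. exp (f x))"
    by (rule Suc.IH[OF Ck_on_lower[OF Suc.prems]])
  have "((\<lambda>x. exp (f x)) has_derivative (\<lambda>v. exp (f x) * frechet_derivative f (at x) v)) (at x)"
    if "x \<in> S" for x
    using has_derivative_compose[OF Ck_on_SucD[OF Suc.prems that]
        DERIV_exp[unfolded has_field_derivative_def]] by (simp add: mult.commute)
  then show ?case
    by (rule Ck_on_SucI[OF assms(1)])
      (assumption | intro Ck_on_mult \<open>open S\<close> inv Suc.prems[THEN Ck_on_frechet_derivative])+
qed

section \<open>The Hermitian form\<close>

definition herm :: "complex ^ 'd \<Rightarrow> complex ^ 'd \<Rightarrow> complex" where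
  "herm z w = (\<Sum>j\<in>UNIV. z $ j * cnj (w $ j))"

lemma herm_add_left: "herm (x + y) z = herm x z + herm y z"
  and herm_add_right: "herm x (y + z) = herm x y + herm x z"
  and herm_scale_left: "herm (u *s x) y = u * herm x y"
  and herm_scale_right: "herm x (u *s y) = cnj u * herm x y"
  by (simp_all add: herm_def sum.distrib algebra_simps sum_distrib_left)

lemma herm_commute: "herm w z = cnj (herm z w)"
  by (simp add: herm_def mult.commute)

lemma Re_herm: "Re (herm z w) = z \<bullet> w"
  by (simp add: herm_def inner_vec_def inner_complex_def)

lemma herm_self: "herm z z = of_real ((norm z)\<^sup>2)"
proof (rule complex_eqI)
  have "Im (herm z z) = - Im (herm z z)"
    by (subst herm_commute) simp
  then show "Im (herm z z) = Im (of_real ((norm z)\<^sup>2))" by simp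
qed (simp add: Re_herm power2_norm_eq_inner)

lemma norm_smult: "norm (u *s (z :: complex ^ 'd)) = norm u * norm z"
  by (simp add: norm_vec_def L2_set_right_distrib[symmetric] norm_mult)

text \<open>The Cauchy-Schwarz inequality, read off from \<open>0 \<le> \<parallel>z - a p\<parallel>\<^sup>2 = 1 - \<bar>a\<bar>\<^sup>2\<close> with
  \<open>a = herm z p\<close>.\<close>

lemma norm_herm_le:
  fixes p z :: "complex ^ 'd"
  assumes "norm p = 1" "norm z = 1"
  shows "norm (herm z p) \<le> 1"
proof -
  define a where "a = herm z p"
  have "0 \<le> Re (herm (z + (- a) *s p) (z + (- a) *s p))"
    by (simp only: herm_self Re_complex_of_real zero_le_power2)
  also have "herm (z + (- a) *s p) (z + (- a) *s p) = 1 - a * cnj a"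
    using assms herm_commute[of p z]
    by (simp only: herm_add_left herm_add_right herm_scale_left herm_scale_right)
       (simp add: herm_self algebra_simps flip: a_def)
  finally have "(norm a)\<^sup>2 \<le> 1"
    by (simp add: complex_mult_cnj cmod_power2)
  then show ?thesis
    by (simp add: a_def abs_square_le_1)
qed

text \<open>The real part of \<open>herm z v\<close> is the inner product, which vanishes on the tangent space of the
  sphere, and its imaginary part is \<open>-2\<close> times the contact form. So the contact plane is the complex
  hyperplane orthogonal to \<open>z\<close>.\<close>

lemma std_contact_structure_iff: "v \<in> std_contact_structure z \<longleftrightarrow> herm z v = 0"
proof -
  have "(\<Sum>j\<in>UNIV. z $ j * cnj (v $ j) - cnj (z $ j) * v $ j) = herm z v - cnj (herm z v)"
    by (simp add: herm_def sum_subtractf)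
  also have "\<dots> = 2 * \<i> * Im (herm z v)"
    by (simp add: complex_eq_iff)
  finally show ?thesis
    by (auto simp: std_contact_structure_def sphere_tangent_space_def std_contact_form_def
        complex_eq_iff simp flip: Re_herm)
qed

lemma bounded_linear_herm: "bounded_linear (\<lambda>z. herm z p)"
  unfolding linear_conv_bounded_linear[symmetric]
  by (rule linearI) (simp_all add: herm_def sum.distrib algebra_simps scaleR_sum_right)

lemma bounded_bilinear_smult: "bounded_bilinear ((*s) :: complex \<Rightarrow> complex ^ 'd \<Rightarrow> _)"
  unfolding bilinear_conv_bounded_bilinear[symmetric] bilinear_def
  by (auto intro!: linearI simp: vec_eq_iff algebra_simps)

section \<open>Hyperbolic automorphisms of the ball\<close>

text \<open>
  Writing \<open>z = a p + w\<close> with \<open>w\<close> orthogonal to the unit vector \<open>p\<close>, the Lorentz boost of \<open>(z, 1)\<close>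
  along \<open>p\<close> has the spatial part \<open>(cosh r a - sinh r) p + w\<close> and the last coordinate
  \<open>cosh r - sinh r a\<close>. These are the numerator and the denominator below, and \<open>boost\<close> is the induced
  map of projective space in the affine chart.
\<close>

definition boost_den :: "complex ^ 'd \<Rightarrow> real \<Rightarrow> complex ^ 'd \<Rightarrow> complex" where
  "boost_den p r z = of_real (cosh r) - of_real (sinh r) * herm z p"

definition boost_num :: "complex ^ 'd \<Rightarrow> real \<Rightarrow> complex ^ 'd \<Rightarrow> complex ^ 'd" where
  "boost_num p r z = z + ((of_real (cosh r) - 1) * herm z p - of_real (sinh r)) *s p"

definition boost :: "complex ^ 'd \<Rightarrow> real \<Rightarrow> complex ^ 'd \<Rightarrow> complex ^ 'd" where
  "boost p r z = inverse (boost_den p r z) *s boost_num p r z"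

lemma cosh_sinh_square: "(of_real (cosh r) :: complex)\<^sup>2 = 1 + (of_real (sinh r))\<^sup>2"
  using cosh_square_eq[of r] by (metis add.commute of_real_1 of_real_add of_real_power)

text \<open>On the sphere \<open>\<bar>herm z p\<bar> \<le> 1\<close>, while \<open>\<bar>sinh r\<bar> < cosh r\<close>.\<close>

lemma boost_den_nonzero:
  assumes "norm p = 1" "norm z = 1"
  shows "boost_den p r z \<noteq> 0"
proof
  assume "boost_den p r z = 0"
  then have "complex_of_real (cosh r) = of_real (sinh r) * herm z p"
    by (simp add: boost_den_def)
  then have "norm (complex_of_real (cosh r)) = norm (of_real (sinh r) * herm z p)"
    by (rule arg_cong)
  then have "cosh r = \<bar>sinh r\<bar> * norm (herm z p)"
    using cosh_real_nonneg[of r] by (simp add: norm_mult)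
  also have "\<dots> \<le> \<bar>sinh r\<bar>"
    using norm_herm_le[OF assms] by (simp add: mult_left_le)
  finally show False
    using sinh_less_cosh_real[of r] sinh_less_cosh_real[of "- r"] by (simp add: abs_le_iff)
qed

lemma herm_boost_num:
  assumes "norm p = 1"
  shows "herm (boost_num p r z) p = of_real (cosh r) * herm z p - of_real (sinh r)"
  unfolding boost_num_def herm_add_left herm_scale_left
  by (simp add: assms herm_self algebra_simps)

text \<open>Lorentz boosts are isometries of the form of signature \<open>(d, 1)\<close>; here this is stated for the two
  vectors \<open>(z, 1)\<close> and \<open>(w, 1)\<close>.\<close>

lemma herm_boost_num_polarised:
  assumes "norm p = 1"
  shows "herm (boost_num p r z) (boost_num p r w) - boost_den p r z * cnj (boost_den p r w)
    = herm z w - 1"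
proof -
  have *: "herm p p = 1" "herm p w = cnj (herm w p)"
    using assms by (simp_all add: herm_self flip: herm_commute)
  show ?thesis
    using cosh_sinh_square[of r]
    unfolding boost_num_def boost_den_def herm_add_left herm_add_right herm_scale_left
      herm_scale_right * complex_cnj_diff complex_cnj_mult complex_cnj_complex_of_real complex_cnj_one
    by algebra
qed

text \<open>The sphere is the projectivised null cone of the form of signature \<open>(d, 1)\<close>, which is preserved by
  every isometry of this form.\<close>

lemma norm_boost:
  assumes "norm p = 1" "norm z = 1"
  shows "norm (boost p r z) = 1"
proof -
  have "of_real ((norm (boost_num p r z))\<^sup>2) = (of_real ((norm (boost_den p r z))\<^sup>2) :: complex)"
    using herm_boost_num_polarised[OF assms(1), of r z z] assms(2)
    by (simp add: herm_self flip: complex_norm_square)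
  then have "norm (boost_num p r z) = norm (boost_den p r z)"
    unfolding of_real_eq_iff by simp
  then show ?thesis
    using boost_den_nonzero[OF assms, of r] by (simp add: boost_def norm_smult norm_inverse)
qed

text \<open>Boosts along \<open>p\<close> form a one-parameter group. This provides the smooth inverse of the maps in the
  isotopy.\<close>

lemma boost_minus_boost:
  assumes "norm p = 1" "norm z = 1"
  shows "boost p (- r) (boost p r z) = z"
proof -
  define d c s a where "d = boost_den p r z" and "c = complex_of_real (cosh r)"
    and "s = complex_of_real (sinh r)" and "a = herm z p"
  have d: "d \<noteq> 0" "d = c - s * a"
    using boost_den_nonzero[OF assms] by (auto simp: d_def c_def s_def a_def boost_den_def)
  have cs: "c\<^sup>2 = 1 + s\<^sup>2" using cosh_sinh_square by (simp add: c_def s_def)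
  have h: "herm (boost p r z) p = (c * a - s) / d"
    using herm_boost_num[OF assms(1), of r z]
    by (simp add: boost_def herm_scale_left d_def c_def s_def a_def field_simps)
  have "boost_den p (- r) (boost p r z) = c + s * ((c * a - s) / d)"
    unfolding boost_den_def h by (simp add: c_def s_def)
  also have "\<dots> = (c * d + s * (c * a - s)) / d"
    using d(1) by (simp add: field_simps)
  also have "c * d + s * (c * a - s) = 1"
    using cs unfolding d(2) by algebra
  finally have den: "boost_den p (- r) (boost p r z) = 1 / d" .
  have "boost p (- r) (boost p r z) $ j = z $ j" for j
  proof -
    have "boost p (- r) (boost p r z) $ j
      = d * (((z $ j + ((c - 1) * a - s) * p $ j) / d) + ((c - 1) * ((c * a - s) / d) + s) * p $ j)"
      unfolding boost_def[of p "- r"] den boost_num_def h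
      by (simp add: boost_def boost_num_def c_def s_def a_def d_def field_simps)
    also have "\<dots> = z $ j + ((c - 1) * a - s) * p $ j + ((c - 1) * (c * a - s) + s * d) * p $ j"
      using d(1) by (simp add: field_simps)
    also have "\<dots> = z $ j"
      using cs unfolding d(2) by algebra
    finally show ?thesis .
  qed
  then show ?thesis by (simp add: vec_eq_iff)
qed

text \<open>The quotient rule for \<open>boost\<close>, with the numerator already expressed through \<open>boost p r z\<close>.\<close>

definition boost_deriv :: "complex ^ 'd \<Rightarrow> real \<Rightarrow> complex ^ 'd \<Rightarrow> complex ^ 'd \<Rightarrow> complex ^ 'd" where
  "boost_deriv p r z v = inverse (boost_den p r z) *s
     (v + ((of_real (cosh r) - 1) * herm v p) *s p
       + (of_real (sinh r) * herm v p) *s boost p r z)"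

lemma has_derivative_boost:
  assumes "boost_den p r z \<noteq> 0"
  shows "(boost p r has_derivative boost_deriv p r z) (at z)"
proof -
  note h = bounded_linear.has_derivative[OF bounded_linear_herm has_derivative_ident, of p]
  have den: "(boost_den p r has_derivative (\<lambda>v. - (of_real (sinh r) * herm v p))) (at z)"
    unfolding boost_den_def by (auto intro!: derivative_eq_intros h)
  have num: "(boost_num p r has_derivative (\<lambda>v. v + ((of_real (cosh r) - 1) * herm v p) *s p)) (at z)"
    unfolding boost_num_def
    by (auto intro!: derivative_eq_intros h
        bounded_linear.has_derivative[OF bounded_bilinear.bounded_linear_left[OF bounded_bilinear_smult]])
  have "(boost p r has_derivative (\<lambda>v. inverse (boost_den p r z) *s
       (v + ((of_real (cosh r) - 1) * herm v p) *s p)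
      + (- (inverse (boost_den p r z) * - (of_real (sinh r) * herm v p) * inverse (boost_den p r z)))
         *s boost_num p r z)) (at z)"
    unfolding boost_def
    by (rule bounded_bilinear.FDERIV[OF bounded_bilinear_smult Deriv.has_derivative_inverse[OF assms den] num])
  then show ?thesis
    by (rule has_derivative_eq_rhs)
      (auto simp: fun_eq_iff boost_deriv_def boost_def vec_eq_iff algebra_simps)
qed

text \<open>The infinitesimal form of the isometry identity: apply it to \<open>z\<close> and \<open>z + v\<close>. Numerator and
  denominator are affine in \<open>v\<close>, so the constant terms cancel and the terms linear in \<open>v\<close> remain.
  In particular \<open>v\<close> is in the contact plane at \<open>z\<close> exactly if its image is in the contact plane at
  the image point.\<close>

lemma boost_deriv_conformal:
  assumes "norm p = 1" "norm z = 1"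
  shows "herm (boost p r z) (boost_deriv p r z v) = herm z v / of_real ((norm (boost_den p r z))\<^sup>2)"
proof -
  define d where "d = boost_den p r z"
  have d: "d \<noteq> 0" using boost_den_nonzero[OF assms] by (simp add: d_def)
  have bb: "herm (boost p r z) (boost p r z) = 1"
    using norm_boost[OF assms] by (simp add: herm_self)
  have num: "boost_num p r z = d *s boost p r z"
    using d by (simp add: boost_def d_def)
  define V where "V = v + ((of_real (cosh r) - 1) * herm v p) *s p"
  have num_add: "boost_num p r (z + v) = d *s boost p r z + V"
    by (simp add: boost_num_def V_def herm_add_left vec_eq_iff algebra_simps flip: num)
  have den_add: "boost_den p r (z + v) = d - of_real (sinh r) * herm v p"
    by (simp add: boost_den_def d_def herm_add_left algebra_simps)
  have "herm z z = 1"
    using assms(2) by (simp add: herm_self)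
  then have eq: "d * herm (boost p r z) V + d * cnj (of_real (sinh r) * herm v p) = herm z v"
    using herm_boost_num_polarised[OF assms(1), of r z "z + v"]
    unfolding num num_add den_add d_def[symmetric] herm_add_right herm_scale_left herm_scale_right bb
      complex_cnj_diff
    by algebra
  have "herm (boost p r z) (boost_deriv p r z v)
    = inverse (cnj d) * (herm (boost p r z) V + cnj (of_real (sinh r) * herm v p))"
    unfolding boost_deriv_def V_def[symmetric] d_def[symmetric]
    by (simp add: herm_add_right herm_scale_right bb distrib_left)
  also have "\<dots> = herm z v / (d * cnj d)"
    using d by (simp add: field_simps flip: eq)
  also have "d * cnj d = of_real ((norm d)\<^sup>2)"
    unfolding complex_norm_square by (rule refl)
  finally show ?thesis by (simp add: d_def)
qed

text \<open>If the derivative kills \<open>v\<close>, pairing this equation with \<open>p\<close> gives an equation in \<open>b = herm v p\<close>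
  alone, which reduces to \<open>(cosh\<^sup>2 r - sinh\<^sup>2 r) b = 0\<close>; and \<open>b = 0\<close> leaves \<open>v = 0\<close>.\<close>

lemma inj_boost_deriv:
  assumes "norm p = 1" "norm z = 1"
  shows "inj (boost_deriv p r z)"
proof -
  have lin: "linear (boost_deriv p r z)"
    using has_derivative_linear[OF has_derivative_boost[OF boost_den_nonzero[OF assms]]] .
  have "v = 0" if v: "boost_deriv p r z v = 0" for v
  proof -
    define d c s a b where "d = boost_den p r z" and "c = complex_of_real (cosh r)"
      and "s = complex_of_real (sinh r)" and "a = herm z p" and "b = herm v p"
    have d: "d \<noteq> 0" "d = c - s * a"
      using boost_den_nonzero[OF assms] by (auto simp: d_def c_def s_def a_def boost_den_def)
    have cs: "c\<^sup>2 = 1 + s\<^sup>2" using cosh_sinh_square by (simp add: c_def s_def)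
    have 0: "v + ((c - 1) * b) *s p + (s * b) *s boost p r z = 0"
      using v d(1) unfolding boost_deriv_def vector_mul_eq_0 by (simp add: d_def c_def s_def b_def)
    have "herm (boost p r z) p = (c * a - s) / d"
      using herm_boost_num[OF assms(1), of r z]
      by (simp add: boost_def herm_scale_left d_def c_def s_def a_def field_simps)
    then have "b + (c - 1) * b + s * b * ((c * a - s) / d) = herm 0 p"
      using assms(1) by (simp add: herm_add_left herm_scale_left herm_self b_def flip: 0)
    then have "c * b * d + s * b * (c * a - s) = 0"
      using d(1) by (simp add: herm_def field_simps)
    then have "b = 0"
      using cs unfolding d(2) by algebra
    then show "v = 0" using 0 by simp
  qed
  then show ?thesis using lin by (simp add: linear_injective_0)
qed

section \<open>Contact isotopies made of rotated boosts\<close>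

text \<open>The derivative maps contact planes into contact planes by \<open>boost_deriv_conformal\<close>. It is injective
  on the ambient space, hence surjective, and since the conformal identity also detects membership in
  the contact plane, each contact plane is mapped onto the one at the image point.\<close>

lemma preserves_distribution_rotated_boost:
  fixes p :: "complex ^ 'd"
  assumes "norm p = 1" "norm u = 1"
  shows "preserves_distribution (sphere 0 1) std_contact_structure (\<lambda>z. u *s boost p r z)"
  unfolding preserves_distribution_def
proof (intro ballI exI conjI)
  fix z :: "complex ^ 'd" assume "z \<in> sphere 0 1"
  then have z: "norm z = 1" by simp
  have u: "u * cnj u = 1" using assms(2) by (simp flip: complex_norm_square)
  note d = boost_den_nonzero[OF assms(1) z, of r]
  have D: "((\<lambda>z. u *s boost p r z) has_derivative (\<lambda>v. u *s boost_deriv p r z v)) (at z)"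
    by (rule bounded_linear.has_derivative
        [OF bounded_bilinear.bounded_linear_right[OF bounded_bilinear_smult] has_derivative_boost[OF d]])
  then show "((\<lambda>z. u *s boost p r z) has_derivative (\<lambda>v. u *s boost_deriv p r z v))
      (at z within sphere 0 1)"
    by (rule has_derivative_at_withinI)
  have lin: "linear (\<lambda>v. u *s boost_deriv p r z v)"
    by (rule has_derivative_linear[OF D])
  have "u \<noteq> 0" using assms(2) by auto
  then have "inj (\<lambda>v. u *s boost_deriv p r z v)"
    using inj_boost_deriv[OF assms(1) z, of r] by (auto simp: inj_on_def)
  then have surj: "surj (\<lambda>v. u *s boost_deriv p r z v)"
    by (rule linear_injective_imp_surjective[OF lin]) simp
  have "herm (u *s boost p r z) (u *s boost_deriv p r z v) = 0 \<longleftrightarrow> herm z v = 0" for v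
    using u d boost_deriv_conformal[OF assms(1) z, of r v] \<open>u \<noteq> 0\<close>
    by (simp add: herm_scale_left herm_scale_right)
  then have "v \<in> std_contact_structure z \<longleftrightarrow>
      u *s boost_deriv p r z v \<in> std_contact_structure (u *s boost p r z)" for v
    by (simp add: std_contact_structure_iff)
  then have "std_contact_structure z =
      (\<lambda>v. u *s boost_deriv p r z v) -` std_contact_structure (u *s boost p r z)"
    by blast
  then show "(\<lambda>v. u *s boost_deriv p r z v) ` std_contact_structure z
      = std_contact_structure (u *s boost p r z)"
    using surj by (simp only: surj_image_vimage_eq)
qed

lemma Ck_on_boost:
  assumes "open S" "\<And>y. y \<in> S \<Longrightarrow> boost_den p (r y) (f y) \<noteq> 0"
    and r: "Ck_on k S r" and f: "Ck_on k S f"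
  shows "Ck_on k S (\<lambda>y. boost p (r y) (f y))"
proof -
  note C = \<open>open S\<close> Ck_on_add Ck_on_mult Ck_on_const Ck_on_exp Ck_on_inverse
    Ck_on_bounded_linear_compose[OF _ bounded_linear_of_real]
    Ck_on_bounded_linear_compose[OF _ bounded_linear_herm]
    Ck_on_bounded_linear_compose[OF _ bounded_linear_minus[OF bounded_linear_ident]]
    Ck_on_bounded_bilinear[OF _ bounded_bilinear_smult]
  have c: "Ck_on k S (\<lambda>y. complex_of_real (cosh (r y)))"
    unfolding cosh_def real_scaleR_def by (intro C r)
  have s: "Ck_on k S (\<lambda>y. complex_of_real (sinh (r y)))"
    unfolding sinh_def real_scaleR_def diff_conv_add_uminus by (intro C r)
  have "Ck_on k S (\<lambda>y. boost_den p (r y) (f y))"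
    unfolding boost_den_def diff_conv_add_uminus by (intro C c s f)
  moreover have "Ck_on k S (\<lambda>y. boost_num p (r y) (f y))"
    unfolding boost_num_def diff_conv_add_uminus by (intro C c s f)
  ultimately show ?thesis
    unfolding boost_def by (intro C assms(2))
qed

text \<open>The formula for \<open>boost\<close> is its own smooth extension to the open set where the denominator does not
  vanish. The parameter \<open>r\<close>, the point \<open>f\<close> and the phase \<open>u\<close> may all vary with \<open>y\<close>, so that the lemma
  applies to the isotopy as a function of time and space, to each map in it and to its inverse.\<close>

lemma smooth_on_rotated_boost:
  fixes p :: "complex ^ 'd"
  assumes "\<And>y. y \<in> A \<Longrightarrow> boost_den p (r y) (f y) \<noteq> 0"
    and r: "\<And>k T. open T \<Longrightarrow> Ck_on k T r" and f: "\<And>k T. open T \<Longrightarrow> Ck_on k T f"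
    and u: "\<And>k T. open T \<Longrightarrow> Ck_on k T u"
  shows "smooth_on A (\<lambda>y. u y *s boost p (r y) (f y))"
proof -
  define U where "U = {y. boost_den p (r y) (f y) \<noteq> 0}"
  have [continuous_intros]: "continuous_on UNIV r" "continuous_on UNIV f"
    using r[of UNIV 0] f[of UNIV 0] by auto
  have "continuous_on UNIV (\<lambda>y. boost_den p (r y) (f y))"
    unfolding boost_den_def
    by (intro continuous_intros bounded_linear.continuous_on[OF bounded_linear_herm])
  then have "open U"
    unfolding U_def by (rule open_Collect_neq) (auto intro: continuous_intros)
  moreover have "Ck_on k U (\<lambda>y. u y *s boost p (r y) (f y))" for k
    using \<open>open U\<close>
    by (intro Ck_on_bounded_bilinear[OF _ bounded_bilinear_smult] Ck_on_boost r f u)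
      (auto simp: U_def)
  ultimately show ?thesis
    unfolding smooth_on_def using assms(1)
    by (intro ballI exI[of _ U] exI[of _ "\<lambda>y. u y *s boost p (r y) (f y)"]) (auto simp: U_def)
qed


lemma smooth_on_cong:
  assumes "smooth_on A f" "\<And>x. x \<in> A \<Longrightarrow> f x = g x"
  shows "smooth_on A g"
  unfolding smooth_on_def
proof
  fix x assume "x \<in> A"
  then obtain U h where "open U" "x \<in> U" "\<forall>k. Ck_on k U h" "\<forall>y\<in>U \<inter> A. h y = f y"
    using assms(1) unfolding smooth_on_def by blast
  then show "\<exists>U h. open U \<and> x \<in> U \<and> (\<forall>k. Ck_on k U h) \<and> (\<forall>y\<in>U \<inter> A. h y = g y)"
    using assms(2) by (intro exI[of _ U] exI[of _ h]) auto
qed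

text \<open>The inverse of \<open>z \<mapsto> u boost p r z\<close> is \<open>z \<mapsto> boost p (-r) (cnj u z)\<close>, because \<open>\<bar>u\<bar> = 1\<close>.\<close>

lemma diffeomorphism_rotated_boost:
  fixes p :: "complex ^ 'd"
  assumes p: "norm p = 1" and u: "norm u = 1"
  shows "diffeomorphism_of (sphere 0 1) (\<lambda>z. u *s boost p r z)"
proof -
  let ?f = "\<lambda>z. u *s boost p r z" and ?g = "\<lambda>z. boost p (- r) (cnj u *s z)"
  have uu: "u * cnj u = 1" "cnj u * u = 1"
    using u by (simp_all add: mult.commute flip: complex_norm_square)
  have f_sph: "?f z \<in> sphere 0 1" and g_sph: "?g z \<in> sphere 0 1"
    and gf: "?g (?f z) = z" and fg: "?f (?g z) = z" if "z \<in> sphere 0 1" for z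
  proof -
    have z: "norm z = 1" "norm (cnj u *s z) = 1" using that u by (simp_all add: norm_smult)
    show "?f z \<in> sphere 0 1" "?g z \<in> sphere 0 1"
      using norm_boost[OF p z(1)] norm_boost[OF p z(2)] u by (simp_all add: norm_smult)
    show "?g (?f z) = z"
      using boost_minus_boost[OF p z(1)] by (simp add: vector_smult_assoc uu)
    show "?f (?g z) = z"
      using boost_minus_boost[OF p z(2), of "- r"] by (simp add: vector_smult_assoc uu)
  qed
  have bij: "bij_betw ?f (sphere 0 1) (sphere 0 1)"
    by (rule bij_betw_byWitness[where f' = ?g]) (use f_sph g_sph gf fg in auto)
  have "smooth_on (sphere 0 1) ?f"
    by (rule smooth_on_rotated_boost)
      (auto intro: Ck_on_const Ck_on_bounded_linear bounded_linear_ident simp: boost_den_nonzero p)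
  \<comment> \<open>The trivial phase puts the inverse into the form of \<open>smooth_on_rotated_boost\<close>.\<close>
  moreover have "smooth_on (sphere 0 1) (\<lambda>z. 1 *s ?g z)"
    by (rule smooth_on_rotated_boost)
      (auto intro!: Ck_on_const Ck_on_bounded_linear
        bounded_bilinear.bounded_linear_right[OF bounded_bilinear_smult]
        simp: norm_smult u boost_den_nonzero p)
  then have "smooth_on (sphere 0 1) (inv_into (sphere 0 1) ?f)"
  proof (rule smooth_on_cong)
    fix z :: "complex ^ 'd" assume z: "z \<in> sphere 0 1"
    show "1 *s ?g z = inv_into (sphere 0 1) ?f z"
      using bij_betw_inv_into_left[OF bij g_sph[OF z]] fg[OF z] by simp
  qed
  ultimately show ?thesis
    using bij by (simp add: diffeomorphism_of_def)
qed

lemma contact_isotopy_rotated_boost: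
  fixes p :: "complex ^ 'd"
  assumes p: "norm p = 1"
  shows "contact_isotopy (sphere 0 1) std_contact_structure
    (\<lambda>t z. exp (\<i> * of_real (b * t)) *s boost p (k * t) z)"
  unfolding contact_isotopy_def
proof (intro conjI ballI)
  have fst: "bounded_linear (\<lambda>y :: real \<times> (complex ^ 'd). c * fst y)" for c :: real
    by (intro bounded_linear_const_mult bounded_linear_fst)
  have "smooth_on ({0..1} \<times> sphere 0 1)
      (\<lambda>y. exp (\<i> * of_real (b * fst y)) *s boost p (k * fst y) (snd y))"
  proof (rule smooth_on_rotated_boost)
    fix m and T :: "(real \<times> (complex ^ 'd)) set" assume T: "open T"
    show "Ck_on m T (\<lambda>y. k * fst y)" "Ck_on m T (\<lambda>y. snd y)"
      using T by (intro Ck_on_bounded_linear fst bounded_linear_snd; simp)+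
    show "Ck_on m T (\<lambda>y. exp (\<i> * of_real (b * fst y)))"
      by (intro Ck_on_exp[OF T] Ck_on_mult[OF T] Ck_on_const[OF T]
        Ck_on_bounded_linear_compose[OF T bounded_linear_of_real] Ck_on_bounded_linear[OF T] fst)
  qed (auto simp: boost_den_nonzero p)
  then show "smooth_on ({0..1} \<times> sphere 0 1)
      (\<lambda>(t, z). exp (\<i> * of_real (b * t)) *s boost p (k * t) z)"
    by (simp add: case_prod_unfold)
  fix t :: real
  have "norm (exp (\<i> * of_real (b * t))) = 1"
    by (rule norm_exp_i_times)
  then show "diffeomorphism_of (sphere 0 1) (\<lambda>z. exp (\<i> * of_real (b * t)) *s boost p (k * t) z)"
    and "preserves_distribution (sphere 0 1) std_contact_structure
      (\<lambda>z. exp (\<i> * of_real (b * t)) *s boost p (k * t) z)"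
    by (rule diffeomorphism_rotated_boost[OF p] preserves_distribution_rotated_boost[OF p])+
qed

section \<open>Contraction towards the antipode and displacement\<close>

text \<open>
  Put \<open>a = herm z p\<close> and \<open>\<delta> = boost_den p r z\<close>. In the \<open>p\<close>-direction the boost acts by
  \<open>a \<mapsto> (cosh r a - sinh r) / \<delta>\<close>, so \<open>1 + herm (boost p r z) p = exp (-r) (1 + a) / \<delta>\<close>, which
  bounds \<open>\<parallel>boost p r z + p\<parallel>\<^sup>2\<close> by \<open>4 exp (-r) / \<bar>\<delta>\<bar>\<close>. On the other hand
  \<open>\<bar>\<delta>\<bar> \<ge> Re \<delta> \<ge> exp r (1 - Re a) / 2\<close>, and \<open>2 (1 - Re a) = \<parallel>z - p\<parallel>\<^sup>2\<close>.
\<close>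

lemma boost_attracts_to_antipode:
  assumes p: "norm p = 1" and z: "norm z = 1"
  shows "norm (boost p r z + p) * norm (z - p) \<le> 4 * exp (- r)"
proof -
  define d a where "d = boost_den p r z" and "a = herm z p"
  have d: "d \<noteq> 0" "d = of_real (cosh r) - of_real (sinh r) * a"
    using boost_den_nonzero[OF p z] by (auto simp: d_def a_def boost_den_def)
  have a: "norm a \<le> 1" unfolding a_def by (rule norm_herm_le[OF p z])
  have zp: "(norm (z - p))\<^sup>2 = 2 * (1 - Re a)"
    using p z by (simp add: power2_norm_eq_inner inner_diff inner_commute a_def Re_herm
        norm_eq_1)
  have "herm (boost p r z) p = (of_real (cosh r) * a - of_real (sinh r)) / d"
    using herm_boost_num[OF p, of r z]
    by (simp add: boost_def herm_scale_left d_def a_def field_simps)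
  then have "1 + herm (boost p r z) p = (d + (of_real (cosh r) * a - of_real (sinh r))) / d"
    using d(1) by (simp add: add_divide_distrib)
  also have "\<dots> = of_real (cosh r - sinh r) * (1 + a) / d"
    unfolding d(2) by (simp add: algebra_simps)
  finally have "1 + herm (boost p r z) p = of_real (cosh r - sinh r) * (1 + a) / d" .
  then have "norm (1 + herm (boost p r z) p) = exp (- r) * norm (1 + a) / norm d"
    unfolding cosh_minus_sinh by (simp add: norm_mult norm_divide)
  also have "\<dots> \<le> exp (- r) * 2 / norm d"
    using norm_triangle_ineq[of 1 a] a by (intro divide_right_mono mult_left_mono) auto
  finally have F: "norm (1 + herm (boost p r z) p) \<le> 2 * (exp (- r) / norm d)"
    by (simp add: mult.commute)
  have "(norm (boost p r z + p))\<^sup>2 = 2 * Re (1 + herm (boost p r z) p)"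
    using p norm_boost[OF p z, of r]
    by (simp add: power2_norm_eq_inner inner_add inner_commute Re_herm norm_eq_1)
  then have Fp: "(norm (boost p r z + p))\<^sup>2 \<le> 4 * (exp (- r) / norm d)"
    using F complex_Re_le_cmod[of "1 + herm (boost p r z) p"] by linarith
  have "4 * Re d = 2 * (1 - Re a) * exp r + 2 * ((1 + Re a) * exp (- r))"
    unfolding cosh_plus_sinh[symmetric] cosh_minus_sinh[symmetric]
    by (simp add: d(2) algebra_simps)
  moreover have "0 \<le> (1 + Re a) * exp (- r)"
    using a abs_Re_le_cmod[of a] by simp
  ultimately have "(norm (z - p))\<^sup>2 * exp r \<le> 4 * norm d"
    using complex_Re_le_cmod[of d] unfolding zp by linarith
  then have "(norm (z - p))\<^sup>2 * exp r * exp (- r) \<le> 4 * norm d * exp (- r)"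
    by (rule mult_right_mono) simp
  then have "(norm (z - p))\<^sup>2 \<le> 4 * exp (- r) * norm d"
    by (simp add: exp_minus field_simps)
  then have "(norm (boost p r z + p))\<^sup>2 * (norm (z - p))\<^sup>2
      \<le> (4 * (exp (- r) / norm d)) * (4 * exp (- r) * norm d)"
    by (intro mult_mono Fp) auto
  also have "\<dots> = (4 * exp (- r))\<^sup>2"
    using d(1) by (simp add: power2_eq_square)
  finally have "(norm (boost p r z + p) * norm (z - p))\<^sup>2 \<le> (4 * exp (- r))\<^sup>2"
    by (simp only: power_mult_distrib)
  then show ?thesis
    by (rule power2_le_imp_le) simp
qed

theorem proposition4p1:
  fixes L :: "(complex ^ 'd) set"
  assumes "CARD('d) \<ge> 2"
    and "closedin (top_of_set (sphere 0 1)) L"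
    and "L \<subset> sphere 0 1"
  shows "displaceable (sphere 0 1) std_contact_structure L"
proof -
  obtain p where p: "norm p = 1" "p \<notin> L"
    using assms(3) unfolding psubset_eq by (metis mem_sphere_0 subsetI subset_antisym)
  have "closed L"
    using assms(2) closedin_closed_trans closed_sphere by blast
  then obtain e where e: "e > 0" and "ball p e \<subseteq> - L"
    using p(2) open_contains_ball[of "- L"] by (auto simp: open_Compl)
  then have far: "e \<le> norm (z - p)" if "z \<in> L" for z
    using that by (force simp: dist_norm norm_minus_commute)
  \<comment> \<open>If \<open>z\<close> and \<open>\<phi> 1 z\<close> both have distance at least \<open>e\<close> from \<open>p\<close>, the contraction estimate gives
    \<open>e\<^sup>2 \<le> 4 exp (-k)\<close>. Any \<open>k\<close> with \<open>exp (-k) < e\<^sup>2 / 4\<close> excludes this.\<close>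
  define k where "k = - ln (e\<^sup>2 / 5)"
  define \<phi> where "\<phi> t z = exp (\<i> * of_real (pi * t)) *s boost p (k * t) z" for t and z :: "complex ^ 'd"
  have "contact_isotopy (sphere 0 1) std_contact_structure \<phi>"
    unfolding \<phi>_def[abs_def] by (rule contact_isotopy_rotated_boost[OF p(1)])
  moreover have "\<phi> 0 z = z" for z
    by (simp add: \<phi>_def boost_def boost_den_def boost_num_def)
  moreover have "\<phi> 1 z \<notin> L" if "z \<in> L" for z
  proof
    assume "\<phi> 1 z \<in> L"
    \<comment> \<open>At time 1 the phase is \<open>-1\<close>.\<close>
    have "norm (\<phi> 1 z - p) = norm (boost p k z + p)"
      using norm_minus_cancel[of "boost p k z + p"] by (simp add: \<phi>_def)
    then have "e * e \<le> norm (boost p k z + p) * norm (z - p)"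
      using far[OF \<open>\<phi> 1 z \<in> L\<close>] far[OF that] e by (intro mult_mono) auto
    also have "\<dots> \<le> 4 * exp (- k)"
      using that assms(3) by (intro boost_attracts_to_antipode p) auto
    also have "\<dots> = 4 * (e\<^sup>2 / 5)"
      using e by (simp add: k_def)
    finally show False
      using e by (simp add: power2_eq_square)
  qed
  ultimately show ?thesis
    unfolding displaceable_def by (intro exI[of _ \<phi>]) auto
qed

end
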